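(* Let $n\ge 2$ be an integer and consider the game $SN(n,A)$ with $A=\{n-1,n\}$. For a position $\mathbf p$ let $s=\Sigma(\mathbf p)\bmod (2n-2)$ (taken in $\{0,\dots,2n-3\}$) and let $o$ be the number of indices $i$ with $p_i$ odd. Then for every position $s$ and $o$ have the same parity. Moreover, a reduced position $\mathbf p$ is a P-position of $SN(n,A)$ if and only if its pair $(s,o)$ belongs to $S_1\cup S_2\cup S_3$, where $S_1=\{(s,o): s\equiv o\pmod 2,\ 0\le s<n-2,\ o\le s\}$, $S_2=\{(n-2,o): o\equiv n\pmod 2,\ 0\le o\le n-2\}$, $S_3=\{(s,o): s\equiv o\pmod 2,\ n-2<s<2n-3,\ o\le 2(n-2)-s\}$.
   Context: For an integer $n\ge 1$ and a nonempty set $A\subseteq\{1,\dots,n\}$, the game $SN(n,A)$ (Slow SetNim) is played on $n$ stacks of tokens; a position is $\mathbf p=(p_1,\dots,p_n)$ of nonnegative integers ($p_i$ is the height of stack $i$), written in non-decreasing order so that $p_n=\max_i p_i$; stacks of height $0$ still count as stacks. A move consists of choosing some $\ell\in A$ and $\ell$ distinct stacks, each of height at least $1$, and removing exactly one token from each chosen stack. Players alternate; a player unable to move loses (normal play). A P-position is one from which the player to move loses under optimal play; an N-position is one from which the player to move wins. $\Sigma(\mathbf p)=\sum_i p_i$. A terminal position is one with no legal move. For a position $\mathbf p$, let $\mathcal T(\mathbf p)$ be the set of terminal positions reachable from $\mathbf p$ by finite sequences of legal moves, let $u_i(\mathbf p)=\min\{t_i:\mathbf t\in\mathcal T(\mathbf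 p)\}$, and define the reduction $r(\mathbf p)=\mathbf p-u(\mathbf p)$. The position $\mathbf p$ is reduced if $r(\mathbf p)=\mathbf p$. *)

theory Defs
  imports Main
begin

section \<open>Slow SetNim\<close>

text \<open>
  A position of SN(n,A) is a list of n stack heights; stack number i of the informal numbering
  1, ..., n is list entry i - 1. Listing the heights in non-decreasing order is only a labelling
  convention (the rules do not depend on the order of the stacks), so arbitrary lists of
  length n are allowed and a stack keeps its index throughout a play.
\<close>

definition sn_positions :: "nat \<Rightarrow> nat list set" where
  "sn_positions n = {p. length p = n}"

definition sn_move :: "nat \<Rightarrow> nat set \<Rightarrow> nat list \<Rightarrow> nat list \<Rightarrow> bool" where
  "sn_move n A p q \<longleftrightarrow> p \<in> sn_positions n \<and>
     (\<exists>S. S \<subseteq> {..<n} \<and> card S \<in> A \<and> (\<forall>i\<in>S. 1 \<le> p ! i) \<and>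
          q = map (\<lambda>i. if i \<in> S then p ! i - 1 else p ! i) [0..<n])"

definition sn_terminal :: "nat \<Rightarrow> nat set \<Rightarrow> nat list \<Rightarrow> bool" where
  "sn_terminal n A p \<longleftrightarrow> p \<in> sn_positions n \<and> \<not> (\<exists>q. sn_move n A p q)"

text \<open>
  Outcome classes under normal play. The least-fixed-point reading is the right one because,
  for \<open>0 \<notin> A\<close>, every move lowers the total number of tokens, so that all plays are
  finite. Terminal positions are P-positions by the first rule.
\<close>

inductive P_position :: "nat \<Rightarrow> nat set \<Rightarrow> nat list \<Rightarrow> bool"
  and N_position :: "nat \<Rightarrow> nat set \<Rightarrow> nat list \<Rightarrow> bool"
  for n :: nat and A :: "nat set" where
  P_positionI: "\<lbrakk>p \<in> sn_positions n; \<And>q. sn_move n A p q \<Longrightarrow> N_position n A q\<rbrakk> \<Longrightarrow> P_position n A p"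
| N_positionI: "\<lbrakk>p \<in> sn_positions n; sn_move n A p q; P_position n A q\<rbrakk> \<Longrightarrow> N_position n A p"

definition sn_reachable_terminals :: "nat \<Rightarrow> nat set \<Rightarrow> nat list \<Rightarrow> nat list set" where
  "sn_reachable_terminals n A p = {t. (sn_move n A)\<^sup>*\<^sup>* p t \<and> sn_terminal n A t}"

text \<open>
  The infimum below is a minimum, being taken over a set of naturals that is nonempty when
  \<open>0 \<notin> A\<close>. The subtraction in the reduction is never truncated, since heights only
  decrease along a play.
\<close>

definition sn_unplayable :: "nat \<Rightarrow> nat set \<Rightarrow> nat list \<Rightarrow> nat \<Rightarrow> nat" where
  "sn_unplayable n A p i = (INF t \<in> sn_reachable_terminals n A p. t ! i)"

definition sn_reduction :: "nat \<Rightarrow> nat set \<Rightarrow> nat list \<Rightarrow> nat list" where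
  "sn_reduction n A p = map (\<lambda>i. p ! i - sn_unplayable n A p i) [0..<n]"

definition sn_reduced :: "nat \<Rightarrow> nat set \<Rightarrow> nat list \<Rightarrow> bool" where
  "sn_reduced n A p \<longleftrightarrow> sn_reduction n A p = p"

definition sum_residue :: "nat \<Rightarrow> nat list \<Rightarrow> nat" where
  "sum_residue n p = sum_list p mod (2 * n - 2)"

definition odd_count :: "nat list \<Rightarrow> nat" where
  "odd_count p = card {i. i < length p \<and> odd (p ! i)}"

text \<open>For \<open>n \<ge> 2\<close> the subtractions below are not truncated where they matter: the last bound of
  \<open>S3\<close> only counts when \<open>s < 2 * n - 3\<close>.\<close>

definition S1 :: "nat \<Rightarrow> (nat \<times> nat) set" where
  "S1 n = {(s, k). s mod 2 = k mod 2 \<and> 0 \<le> s \<and> s < n - 2 \<and> k \<le> s}"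

definition S2 :: "nat \<Rightarrow> (nat \<times> nat) set" where
  "S2 n = {(s, k). s = n - 2 \<and> k mod 2 = n mod 2 \<and> 0 \<le> k \<and> k \<le> n - 2}"

definition S3 :: "nat \<Rightarrow> (nat \<times> nat) set" where
  "S3 n = {(s, k). s mod 2 = k mod 2 \<and> n - 2 < s \<and> s < 2 * n - 3 \<and> k \<le> 2 * (n - 2) - s}"

end

theory Submission
  imports Defs
begin

text \<open>
  Let \<open>T\<close> be the greatest number with \<open>\<Sum>i. T - p\<^sub>i \<le> T\<close> (truncated differences); it is the length
  of the longest play, since every move spares at most one stack. Tokens above height \<open>T\<close> never
  matter, so the state is described by the deficits \<open>d\<^sub>i = T - p\<^sub>i\<close>. With \<open>e = T - \<Sum>i. d\<^sub>i\<close> the slack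
  and \<open>v\<close> the number of odd deficits, a position is a P-position iff \<open>T\<close> is even and \<open>v \<le> e\<close>, or
  \<open>T\<close> is odd and \<open>v > e + 1\<close>. Indeed, a move sparing a stack with positive deficit lowers that
  deficit and \<open>T\<close> by one and keeps \<open>e\<close>. Every other move lowers \<open>T\<close> and \<open>e\<close> by one and keeps the
  deficits if \<open>e > 0\<close>; if \<open>e = 0\<close>, it lowers \<open>T\<close> by two and every positive deficit by one. In a
  reduced position no stack is higher than \<open>T\<close>, so that the sum of the heights is \<open>(n - 1) T + e\<close>.
\<close>

section \<open>Deficits, horizon and encoding of moves\<close>

definition deficit :: "nat list \<Rightarrow> nat \<Rightarrow> nat" where
  "deficit p T = (\<Sum>i<length p. T - p ! i)"

definition odd_deficits :: "nat list \<Rightarrow> nat \<Rightarrow> nat" where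
  "odd_deficits p T = (\<Sum>i<length p. (T - p ! i) mod 2)"

text \<open>Since \<open>deficit p\<close> is convex in its second argument, the two inequalities
  single out the greatest \<open>T\<close> with \<open>deficit p T \<le> T\<close>.\<close>

definition horizon :: "nat list \<Rightarrow> nat \<Rightarrow> bool" where
  "horizon p T \<longleftrightarrow> deficit p T \<le> T \<and> T + 1 < deficit p (T + 1)"

definition cold :: "nat list \<Rightarrow> nat \<Rightarrow> bool" where
  "cold p T \<longleftrightarrow> (if even T then odd_deficits p T \<le> T - deficit p T
                 else T - deficit p T + 1 < odd_deficits p T)"

text \<open>The move sparing stack \<open>k\<close>; a value \<open>k \<ge> length p\<close> encodes the move that uses all stacks.\<close>

definition sparing_move :: "nat \<Rightarrow> nat list \<Rightarrow> nat list \<Rightarrow> bool" where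
  "sparing_move k p q \<longleftrightarrow> length q = length p \<and>
     (\<forall>i<length p. if i = k then q ! i = p ! i else p ! i = q ! i + 1)"

text \<open>A set of \<open>n - 1\<close> or \<open>n\<close> indices misses at most one index, so
  it is \<open>{..<n} - {k}\<close>, with \<open>k = n\<close> for the full set.\<close>

lemma sn_move_iff_sparing:
  assumes "n \<ge> 2"
  shows "sn_move n {n - 1, n} p q \<longleftrightarrow> length p = n \<and> (\<exists>k. sparing_move k p q)"
proof
  assume "sn_move n {n - 1, n} p q"
  then obtain S where len: "length p = n" and S: "S \<subseteq> {..<n}" "card S \<in> {n - 1, n}"
    and pos: "\<forall>i\<in>S. 1 \<le> p ! i"
    and q: "q = map (\<lambda>i. if i \<in> S then p ! i - 1 else p ! i) [0..<n]"
    unfolding sn_move_def sn_positions_def by blast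
  have "\<exists>k. S = {..<n} - {k}"
  proof (cases "card S = n")
    case True
    then have "S = {..<n}" using S(1) by (intro card_subset_eq) auto
    then have "S = {..<n} - {n}" by simp
    then show ?thesis ..
  next
    case False
    have "card ({..<n} - S) = n - card S"
      using card_Diff_subset[OF finite_subset[OF S(1) finite_lessThan] S(1)] by simp
    then have "card ({..<n} - S) = 1" using S(2) False assms by simp
    then obtain k where "{..<n} - S = {k}" by (auto simp: card_1_singleton_iff)
    then have "S = {..<n} - {k}" using S(1) by auto
    then show ?thesis ..
  qed
  then obtain k where k: "S = {..<n} - {k}" ..
  have "p ! i = p ! i - 1 + 1" if "i < n" "i \<noteq> k" for i
  proof -
    have "1 \<le> p ! i" using pos k that by blast
    then show ?thesis by simp
  qed
  then have "sparing_move k p q"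
    using len unfolding sparing_move_def q k by simp
  then show "length p = n \<and> (\<exists>k. sparing_move k p q)" using len by blast
next
  assume "length p = n \<and> (\<exists>k. sparing_move k p q)"
  then obtain k where len: "length p = n" and k: "sparing_move k p q" by blast
  let ?S = "{..<n} - {k}"
  have size: "card ?S \<in> {n - 1, n}" by (cases "k < n") auto
  have pos: "\<forall>i\<in>?S. 1 \<le> p ! i" using k len by (auto simp: sparing_move_def)
  have q: "q = map (\<lambda>i. if i \<in> ?S then p ! i - 1 else p ! i) [0..<n]"
  proof (rule nth_equalityI)
    show "length q = length (map (\<lambda>i. if i \<in> ?S then p ! i - 1 else p ! i) [0..<n])"
      using k len by (simp add: sparing_move_def)
  next
    fix i
    assume "i < length q"
    then have "i < n" using k len by (simp add: sparing_move_def)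
    moreover have "if i = k then q ! i = p ! i else p ! i = q ! i + 1"
      using k len \<open>i < n\<close> unfolding sparing_move_def by blast
    ultimately show "q ! i = map (\<lambda>i. if i \<in> ?S then p ! i - 1 else p ! i) [0..<n] ! i"
      by (simp split: if_splits)
  qed
  show "sn_move n {n - 1, n} p q"
    unfolding sn_move_def sn_positions_def
  proof (intro conjI exI)
    show "p \<in> {p. length p = n}" using len by simp
  qed (fact Diff_subset size pos q)+
qed

lemma sparing_move_exists:
  assumes "\<forall>i<length p. i \<noteq> k \<longrightarrow> 0 < p ! i"
  obtains q where "sparing_move k p q"
proof
  show "sparing_move k p (map (\<lambda>i. if i = k then p ! i else p ! i - 1) [0..<length p])"
    using assms by (auto simp: sparing_move_def)
qed

section \<open>Effect of a move on horizon and deficits\<close>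

lemma odd_deficits_parity: "odd_deficits p T mod 2 = deficit p T mod 2"
  unfolding deficit_def odd_deficits_def by (rule mod_sum_eq)

lemma pred_mod_2_plus_mod_2: "(x - 1) mod 2 + x mod 2 = (if x = 0 then 0 else 1)" for x :: nat
  by (cases x) (auto simp: mod2_eq_if)

text \<open>Mainly excludes empty stacks: one of height 0 contributes \<open>T\<close> by itself, so
  a second positive term would push \<open>deficit p T\<close> above \<open>T\<close>.\<close>

lemma deficit_two_le:
  assumes "i < length p" "j < length p" "i \<noteq> j"
  shows "(T - p ! i) + (T - p ! j) \<le> deficit p T"
proof -
  have "(\<Sum>l\<in>{i, j}. T - p ! l) \<le> deficit p T"
    unfolding deficit_def using assms by (intro sum_mono2) auto
  then show ?thesis using assms(3) by simp
qed

text \<open>For \<open>T = 0\<close> the horizon requires two empty stacks, as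
  \<open>deficit p 1\<close> counts them, while a legal move tolerates at most one.\<close>

lemma horizon_move_positive:
  assumes "horizon p T" "sparing_move k p q"
  shows "0 < T"
proof (rule ccontr)
  assume "\<not> 0 < T"
  then have "1 < deficit p 1" using assms(1) by (simp add: horizon_def)
  also have "deficit p 1 \<le> (\<Sum>i<length p. if i = k then 1 else 0)"
    unfolding deficit_def using assms(2)
    by (intro sum_mono) (force simp: sparing_move_def split: if_splits)
  also have "\<dots> \<le> 1" by simp
  finally show False by simp
qed

text \<open>Only the spared stack fails to sink along with \<open>T\<close>, so its deficit falls by
  one and the others stay.\<close>

lemma spare_deficient:
  assumes hor: "horizon p T" and mv: "sparing_move k p q" and k: "k < length p" "p ! k < T"
  shows "horizon q (T - 1)" "deficit p T = deficit q (T - 1) + 1"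
    "odd_deficits q (T - 1) + (T - p ! k) mod 2 = odd_deficits p T + (T - 1 - p ! k) mod 2"
proof -
  have len: "length q = length p" using mv by (simp add: sparing_move_def)
  have shift: "t - p ! i = (t - 1 - q ! i) + (if i = k then 1 else 0)"
    if "i < length p" "T \<le> t" for i t
    using that mv k(2) by (auto simp: sparing_move_def split: if_splits)
  have deficit_shift: "deficit p t = deficit q (t - 1) + 1" if "T \<le> t" for t
  proof -
    have "deficit p t = (\<Sum>i<length p. (t - 1 - q ! i) + (if i = k then 1 else 0))"
      unfolding deficit_def using shift that by (intro sum.cong) auto
    then show ?thesis using k(1) len by (simp add: sum.distrib deficit_def)
  qed
  show "deficit p T = deficit q (T - 1) + 1" by (rule deficit_shift) simp
  then show "horizon q (T - 1)"
    using hor deficit_shift[of "T + 1"] k(2) unfolding horizon_def by auto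
  have "q ! k = p ! k" using mv k(1) by (auto simp: sparing_move_def)
  then have "odd_deficits q (T - 1)
      = (T - 1 - p ! k) mod 2 + (\<Sum>i\<in>{..<length p} - {k}. (T - 1 - q ! i) mod 2)"
    unfolding odd_deficits_def using k(1) len by (subst sum.remove[of _ k]) auto
  moreover have "odd_deficits p T
      = (T - p ! k) mod 2 + (\<Sum>i\<in>{..<length p} - {k}. (T - p ! i) mod 2)"
    unfolding odd_deficits_def using k(1) by (subst sum.remove[of _ k]) auto
  moreover have "(\<Sum>i\<in>{..<length p} - {k}. (T - p ! i) mod 2)
      = (\<Sum>i\<in>{..<length p} - {k}. (T - 1 - q ! i) mod 2)"
    using shift by (intro sum.cong) auto
  ultimately show
    "odd_deficits q (T - 1) + (T - p ! k) mod 2 = odd_deficits p T + (T - 1 - p ! k) mod 2"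
    by simp
qed

text \<open>All deficits survive, because a spared stack of height at least \<open>T\<close> has
  deficit 0 before and after; slack lets their total fit under \<open>T - 1\<close>.\<close>

lemma spare_tall_slack:
  assumes hor: "horizon p T" and mv: "sparing_move k p q"
    and k: "k < length p \<Longrightarrow> T \<le> p ! k" and slack: "deficit p T < T"
  shows "horizon q (T - 1)" "deficit q (T - 1) = deficit p T"
    "odd_deficits q (T - 1) = odd_deficits p T"
proof -
  have len: "length q = length p" using mv by (simp add: sparing_move_def)
  have same: "T - 1 - q ! i = T - p ! i" if "i < length p" for i
    using that mv k by (auto simp: sparing_move_def split: if_splits)
  show deficit: "deficit q (T - 1) = deficit p T"
    unfolding deficit_def using same len by (intro sum.cong) auto
  show "odd_deficits q (T - 1) = odd_deficits p T"
    unfolding odd_deficits_def using same len by (intro sum.cong) auto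
  \<comment> \<open>A spared stack of height \<open>T\<close> adds one for \<open>p\<close> at
    \<open>T + 1\<close> but nothing for \<open>q\<close> at \<open>T\<close>; this loss offsets the
    drop of the bound from \<open>T + 1\<close> to \<open>T\<close>.\<close>
  have "deficit p (T + 1) \<le> (\<Sum>i<length p. (T - q ! i) + (if i = k then 1 else 0))"
    unfolding deficit_def using mv k
    by (intro sum_mono) (auto simp: sparing_move_def split: if_splits)
  also have "\<dots> \<le> deficit q T + 1"
    using len by (simp add: sum.distrib deficit_def)
  finally show "horizon q (T - 1)"
    using hor deficit slack unfolding horizon_def by auto
qed

text \<open>Without slack and with at most one positive deficit, the stack carrying it is empty, and
  then no move of this kind is legal.\<close>

lemma spare_tall_tight:
  assumes hor: "horizon p T" and mv: "sparing_move k p q"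
    and k: "k < length p \<Longrightarrow> T \<le> p ! k" and tight: "deficit p T = T"
  obtains z where "2 \<le> z" "2 \<le> T" "horizon q (T - 2)" "deficit q (T - 2) + z = deficit p T"
    "odd_deficits q (T - 2) + odd_deficits p T = z"
proof -
  \<comment> \<open>\<open>z\<close> counts the positive deficits; each of them falls by one and
    changes parity.\<close>
  define z where "z = (\<Sum>i<length p. if T - p ! i = 0 then 0 else 1::nat)"
  have T: "0 < T" using horizon_move_positive[OF hor mv] .
  have len: "length q = length p" using mv by (simp add: sparing_move_def)
  have same: "T - 1 - q ! i = T - p ! i" if "i < length p" for i
    using that mv k by (auto simp: sparing_move_def split: if_splits)
  have drop: "(T - 2 - q ! i) = (T - p ! i) - 1" if "i < length p" for i
    using same[OF that] by simp
  have "\<exists>i<length p. T - p ! i \<noteq> 0"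
  proof (rule ccontr)
    assume "\<not> ?thesis"
    then have "deficit p T = 0" by (simp add: deficit_def)
    then show False using tight T by simp
  qed
  then obtain i where i: "i < length p" "T - p ! i \<noteq> 0" by blast
  \<comment> \<open>Stack \<open>i\<close> loses a token, so its deficit is less than the total
    \<open>T\<close>, and a second positive deficit must exist.\<close>
  then have "i \<noteq> k" using k by auto
  then have "0 < p ! i" using mv i(1) by (auto simp: sparing_move_def)
  then have "T - p ! i < deficit p T" using tight T by simp
  also have "deficit p T = (T - p ! i) + (\<Sum>j\<in>{..<length p} - {i}. T - p ! j)"
    unfolding deficit_def using i(1) by (subst sum.remove[of _ i]) auto
  finally have "(\<Sum>j\<in>{..<length p} - {i}. T - p ! j) \<noteq> 0" by linarith
  then have "\<exists>j\<in>{..<length p} - {i}. T - p ! j \<noteq> 0" by (meson sum.neutral)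
  then obtain j where j: "j < length p" "j \<noteq> i" "T - p ! j \<noteq> 0" by blast
  have "(\<Sum>l\<in>{i, j}. if T - p ! l = 0 then 0 else 1::nat) \<le> z"
    unfolding z_def using i j by (intro sum_mono2) auto
  then have z: "2 \<le> z" using i j by simp
  have T2: "2 \<le> T"
    using deficit_two_le[OF i(1) j(1), of T] i(2) j tight by linarith
  have "deficit q (T - 2) + z
      = (\<Sum>i<length p. ((T - p ! i) - 1) + (if T - p ! i = 0 then 0 else 1))"
    unfolding z_def deficit_def using drop len by (simp add: sum.distrib)
  also have "\<dots> = deficit p T" unfolding deficit_def by (intro sum.cong) auto
  finally have deficit: "deficit q (T - 2) + z = deficit p T" .
  have "odd_deficits q (T - 2) + odd_deficits p T
      = (\<Sum>i<length p. ((T - p ! i) - 1) mod 2 + (T - p ! i) mod 2)"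
    unfolding odd_deficits_def using drop len by (simp add: sum.distrib)
  also have "\<dots> = z"
    unfolding z_def by (intro sum.cong refl pred_mod_2_plus_mod_2)
  finally have odd: "odd_deficits q (T - 2) + odd_deficits p T = z" .
  \<comment> \<open>The total at \<open>T - 1\<close> is still \<open>T\<close>, so
    \<open>T - 1\<close> is too large and the horizon drops to \<open>T - 2\<close>.\<close>
  have "deficit q (T - 1) = deficit p T"
    unfolding deficit_def using same len by (intro sum.cong) auto
  moreover have "T - 2 + 1 = T - 1" using T2 by simp
  ultimately have "horizon q (T - 2)"
    unfolding horizon_def using deficit z T2 tight by simp
  then show thesis using that z T2 deficit odd by blast
qed

section \<open>Cold and hot positions under moves\<close>

text \<open>Let \<open>e\<close> be the slack and \<open>v\<close> the number of odd deficits. The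
  first case flips the parity of \<open>T\<close> and changes \<open>v\<close> by one; the second
  flips it and lowers \<open>e\<close> by one; the third keeps it and turns \<open>v\<close> into
  \<open>z - v\<close> and \<open>e = 0\<close> into \<open>z - 2\<close>. Each breaks the
  inequality of \<open>cold\<close>.\<close>

lemma horizon_after_move:
  assumes hor: "horizon p T" and mv: "sparing_move k p q"
  obtains T' where "T' < T" "horizon q T'" "cold p T \<Longrightarrow> \<not> cold q T'"
proof -
  have T: "0 < T" using horizon_move_positive[OF hor mv] .
  have le: "deficit p T \<le> T" using hor by (simp add: horizon_def)
  consider "k < length p" "p ! k < T" | "k < length p \<Longrightarrow> T \<le> p ! k" "deficit p T < T"
    | "k < length p \<Longrightarrow> T \<le> p ! k" "deficit p T = T"
    using le by linarith
  then show thesis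
  proof cases
    case 1
    note * = spare_deficient[OF hor mv 1]
    have "\<not> cold q (T - 1)" if "cold p T"
    proof -
      have "(T - p ! k) mod 2 + (T - 1 - p ! k) mod 2 = 1"
        using 1(2) pred_mod_2_plus_mod_2[of "T - p ! k"] by simp
      then show ?thesis
        using that *(2,3) T le unfolding cold_def by (auto split: if_splits)
    qed
    then show thesis using that[of "T - 1"] T *(1) by auto
  next
    case 2
    note * = spare_tall_slack[OF hor mv 2]
    have "\<not> cold q (T - 1)" if "cold p T"
      using that *(2,3) T 2 unfolding cold_def by (auto split: if_splits)
    then show thesis using that[of "T - 1"] T *(1) by auto
  next
    case 3
    obtain z where z: "2 \<le> z" "2 \<le> T" "horizon q (T - 2)"
      "deficit q (T - 2) + z = deficit p T" "odd_deficits q (T - 2) + odd_deficits p T = z"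
      using spare_tall_tight[OF hor mv 3] by blast
    have "T - 2 - deficit q (T - 2) = z - 2" using z 3 by linarith
    moreover have "T - deficit p T = 0" using 3 by simp
    ultimately have "\<not> cold q (T - 2)" if "cold p T"
      using that z unfolding cold_def by (auto split: if_splits)
    then show thesis using that[of "T - 2"] z by auto
  qed
qed

text \<open>If \<open>T\<close> is odd, spare a stack with odd deficit; if there is none, or
  \<open>T\<close> is even, use all stacks.\<close>

lemma hot_move:
  assumes hor: "horizon p T" and hot: "\<not> cold p T"
  obtains k q T' where "sparing_move k p q" "T' < T" "horizon q T'" "cold q T'"
proof -
  have le: "deficit p T \<le> T" using hor by (simp add: horizon_def)
  have parity: "odd_deficits p T mod 2 = deficit p T mod 2" by (rule odd_deficits_parity)
  show thesis
  proof (cases "\<exists>k<length p. odd T \<and> odd (T - p ! k)")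
    case True
    then obtain k where k: "k < length p" "odd T" "odd (T - p ! k)" by blast
    then have kT: "p ! k < T" by (cases "p ! k < T") auto
    have "\<forall>i<length p. i \<noteq> k \<longrightarrow> 0 < p ! i"
    proof (intro allI impI)
      fix i assume "i < length p" "i \<noteq> k"
      then show "0 < p ! i"
        using deficit_two_le[of i p k T] k(1) kT le by linarith
    qed
    then obtain q where mv: "sparing_move k p q" by (rule sparing_move_exists)
    note * = spare_deficient[OF hor mv k(1) kT]
    have "(T - p ! k) mod 2 = 1" "(T - 1 - p ! k) mod 2 = 0" using k(3) kT by presburger+
    then have "cold q (T - 1)"
      using hot k(2) * le unfolding cold_def by (auto split: if_splits)
    then show thesis using that[OF mv _ *(1)] kT by simp
  next
    case no_odd: False
    have some_odd: "0 < odd_deficits p T" if "even T"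
      using that hot by (auto simp: cold_def)
    have odd_zero: "odd_deficits p T = 0" if "odd T"
      unfolding odd_deficits_def using that no_odd by auto
    \<comment> \<open>An empty stack has deficit \<open>T\<close>. For odd \<open>T\<close> the case
      excludes this; for even \<open>T\<close> an odd deficit elsewhere would make the total exceed
      \<open>T\<close>.\<close>
    have allpos: "0 < p ! i" if i: "i < length p" for i
    proof (rule ccontr)
      assume "\<not> 0 < p ! i"
      then have pi: "p ! i = 0" by simp
      have eT: "even T" using no_odd i pi by fastforce
      have "\<exists>j<length p. odd (T - p ! j)"
      proof (rule ccontr)
        assume "\<not> ?thesis"
        then have "odd_deficits p T = 0" by (simp add: odd_deficits_def)
        then show False using some_odd[OF eT] by simp
      qed
      then obtain j where j: "j < length p" "odd (T - p ! j)" by blast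
      then have "j \<noteq> i" using pi eT by auto
      moreover have "0 < T - p ! j" using j(2) by (rule odd_pos)
      ultimately show False
        using deficit_two_le[OF i j(1), of T] pi le by simp
    qed
    then have "\<forall>i<length p. i \<noteq> length p \<longrightarrow> 0 < p ! i" by simp
    then obtain q where mv: "sparing_move (length p) p q" by (rule sparing_move_exists)
    have T: "0 < T" using horizon_move_positive[OF hor mv] .
    show thesis
    proof (cases "deficit p T = T")
      case True
      have eT: "even T" using odd_zero True parity by (metis even_iff_mod_2_eq_zero mod_0)
      obtain z where z: "2 \<le> z" "2 \<le> T" "horizon q (T - 2)"
        "deficit q (T - 2) + z = deficit p T" "odd_deficits q (T - 2) + odd_deficits p T = z"
        using spare_tall_tight[OF hor mv _ True] by blast
      have "T - 2 - deficit q (T - 2) = z - 2" using z True by linarith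
      \<comment> \<open>The total \<open>T\<close> is even, so the number of odd deficits is even;
        being positive, it is at least 2.\<close>
      moreover have "2 \<le> odd_deficits p T"
        using some_odd[OF eT] parity True eT by presburger
      ultimately have "cold q (T - 2)"
        using eT z unfolding cold_def by auto
      then show thesis using that[OF mv _ z(3)] z by simp
    next
      case False
      then have slack: "deficit p T < T" using le by simp
      note * = spare_tall_slack[OF hor mv _ slack]
      have "cold q (T - 1)"
        using hot * T slack odd_zero unfolding cold_def by (auto split: if_splits)
      then show thesis using that[OF mv _ *(1)] T by simp
    qed
  qed
qed

section \<open>Outcome classes\<close>

lemma P_N_disjoint:
  shows "P_position n A p \<Longrightarrow> \<not> N_position n A p"
    and "N_position n A p \<Longrightarrow> \<not> P_position n A p"
proof (induction rule: P_position_N_position.inducts)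
  case (P_positionI p)
  then show ?case by (metis N_position.cases)
next
  case (N_positionI p q)
  then show ?case by (metis P_position.cases)
qed

lemma horizon_outcome:
  assumes "n \<ge> 2" "length p = n" "horizon p T"
  shows "if cold p T then P_position n {n - 1, n} p else N_position n {n - 1, n} p"
  using assms(2,3)
proof (induction T arbitrary: p rule: less_induct)
  case (less T)
  note move_iff = sn_move_iff_sparing[OF assms(1)]
  have pos: "p \<in> sn_positions n" using less.prems by (simp add: sn_positions_def)
  show ?case
  proof (cases "cold p T")
    case True
    have "P_position n {n - 1, n} p"
    proof (rule P_positionI[OF pos])
      fix q assume "sn_move n {n - 1, n} p q"
      then obtain k where mv: "sparing_move k p q" using move_iff by blast
      obtain T' where "T' < T" "horizon q T'" "\<not> cold q T'"
        using horizon_after_move[OF less.prems(2) mv] True by blast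
      moreover have "length q = n" using mv less.prems by (simp add: sparing_move_def)
      ultimately show "N_position n {n - 1, n} q" using less.IH by fastforce
    qed
    then show ?thesis using True by simp
  next
    case False
    obtain k q T' where mv: "sparing_move k p q" and q: "T' < T" "horizon q T'" "cold q T'"
      using hot_move[OF less.prems(2) False] by blast
    have "length q = n" using mv less.prems by (simp add: sparing_move_def)
    then have "P_position n {n - 1, n} q" using q less.IH by fastforce
    moreover have "sn_move n {n - 1, n} p q" using mv less.prems move_iff by blast
    ultimately show ?thesis using False N_positionI[OF pos] by auto
  qed
qed

lemma P_position_iff_cold:
  assumes "n \<ge> 2" "length p = n" "horizon p T"
  shows "P_position n {n - 1, n} p \<longleftrightarrow> cold p T"
  using horizon_outcome[OF assms] P_N_disjoint(1)[of n "{n - 1, n}" p]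
  by (auto split: if_splits)

section \<open>Existence of the horizon and heights in reduced positions\<close>

text \<open>With two or more stacks \<open>deficit p t\<close> eventually exceeds \<open>t\<close>;
  the predecessor of the first such \<open>t\<close> is a horizon.\<close>

lemma horizon_exists:
  assumes "length p \<ge> 2"
  obtains T where "horizon p T"
proof -
  define M where "M = (\<Sum>i<length p. p ! i)"
  have "length p * (M + 1) \<le> (\<Sum>i<length p. (M + 1 - p ! i) + p ! i)"
    using sum_mono[of "{..<length p}" "\<lambda>_. M + 1" "\<lambda>i. (M + 1 - p ! i) + p ! i"] by simp
  also have "\<dots> = deficit p (M + 1) + M" by (simp only: sum.distrib deficit_def M_def)
  finally have "length p * (M + 1) \<le> deficit p (M + 1) + M" .
  moreover have "2 * (M + 1) \<le> length p * (M + 1)" using assms by (rule mult_right_mono) simp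
  ultimately have "2 * (M + 1) \<le> deficit p (M + 1) + M" by (rule order_trans[rotated])
  then have big: "M + 1 < deficit p (M + 1)" by simp
  define t where "t = (LEAST t. t < deficit p t)"
  have t: "t < deficit p t" unfolding t_def using big by (rule LeastI)
  have "t \<noteq> 0" using t by (cases "t = 0") (auto simp: deficit_def)
  moreover have "deficit p (t - 1) \<le> t - 1"
    using not_less_Least[of "t - 1" "\<lambda>t. t < deficit p t"] \<open>t \<noteq> 0\<close> by (simp add: t_def not_less)
  ultimately have "horizon p (t - 1)" using t by (simp add: horizon_def)
  then show thesis by (rule that)
qed

text \<open>Ensures that the infimum in \<open>sn_unplayable\<close> is attained; the falling
  horizon ends every play.\<close>

lemma terminal_reachable:
  assumes "n \<ge> 2" "length p = n" "horizon p T"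
  shows "sn_reachable_terminals n {n - 1, n} p \<noteq> {}"
  using assms(2,3)
proof (induction T arbitrary: p rule: less_induct)
  case (less T)
  note move_iff = sn_move_iff_sparing[OF assms(1)]
  show ?case
  proof (cases "sn_terminal n {n - 1, n} p")
    case True
    then show ?thesis by (auto simp: sn_reachable_terminals_def)
  next
    case False
    then obtain q where q: "sn_move n {n - 1, n} p q"
      using less.prems by (auto simp: sn_terminal_def sn_positions_def)
    then obtain k where mv: "sparing_move k p q" using move_iff by blast
    obtain T' where "T' < T" "horizon q T'" using horizon_after_move[OF less.prems(2) mv] by blast
    moreover have "length q = n" using mv less.prems by (simp add: sparing_move_def)
    ultimately have "sn_reachable_terminals n {n - 1, n} q \<noteq> {}" using less.IH by blast
    then show ?thesis
      using q by (auto simp: sn_reachable_terminals_def intro: converse_rtranclp_into_rtranclp)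
  qed
qed

text \<open>A stack loses at most one token per move, while the horizon falls by at least
  one.\<close>

lemma reachable_height_bound:
  assumes "n \<ge> 2" "(sn_move n {n - 1, n})\<^sup>*\<^sup>* p t" "length p = n" "horizon p T" "i < n"
  shows "p ! i \<le> t ! i + T"
  using assms(2-4)
proof (induction arbitrary: T rule: converse_rtranclp_induct)
  case base
  show ?case by simp
next
  case (step p q)
  obtain k where mv: "sparing_move k p q"
    using step.hyps(1) sn_move_iff_sparing[OF assms(1)] by blast
  obtain T' where T': "T' < T" "horizon q T'"
    using horizon_after_move[OF step.prems(2) mv] by blast
  have "length q = n" using mv step.prems by (simp add: sparing_move_def)
  then have "q ! i \<le> t ! i + T'" using step.IH T' by blast
  moreover have "p ! i \<le> q ! i + 1"
    using mv step.prems assms(5) by (auto simp: sparing_move_def split: if_splits)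
  ultimately show ?case using T'(1) by linarith
qed

text \<open>A nonempty stack of a reduced position has unplayable part 0, so some play empties it,
  and no play takes more than \<open>T\<close> tokens from it.\<close>

lemma reduced_height_le:
  assumes n: "n \<ge> 2" and len: "length p = n" and hor: "horizon p T"
    and red: "sn_reduced n {n - 1, n} p" and i: "i < n"
  shows "p ! i \<le> T"
proof (cases "p ! i = 0")
  case False
  let ?R = "sn_reachable_terminals n {n - 1, n} p"
  have "sn_reduction n {n - 1, n} p ! i = p ! i" using red by (simp add: sn_reduced_def)
  then have "(INF t \<in> ?R. t ! i) = 0"
    using False i by (simp add: sn_reduction_def sn_unplayable_def)
  moreover have "(INF t \<in> ?R. t ! i) \<in> (\<lambda>t. t ! i) ` ?R"
    using terminal_reachable[OF n len hor] by (intro Inf_nat_def1) auto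
  ultimately obtain t where "t \<in> ?R" "t ! i = 0" by force
  then show ?thesis
    using reachable_height_bound[OF n _ len hor i, of t] by (simp add: sn_reachable_terminals_def)
qed simp

section \<open>Residues and odd counts\<close>

lemma odd_count_eq_sum: "odd_count p = (\<Sum>i<length p. p ! i mod 2)"
proof -
  have "{i. i < length p \<and> odd (p ! i)} = {i \<in> {..<length p}. odd (p ! i)}" by auto
  then have "odd_count p = (\<Sum>i<length p. if odd (p ! i) then 1 else 0)"
    unfolding odd_count_def by (simp only: card_eq_sum sum.inter_filter finite_lessThan)
  also have "\<dots> = (\<Sum>i<length p. p ! i mod 2)"
    by (intro sum.cong) (auto simp: odd_iff_mod_2_eq_one)
  finally show ?thesis .
qed

lemma sum_list_eq_sum: "sum_list p = (\<Sum>i<length p. p ! i)"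
  by (simp only: sum_list_sum_nth atLeast0LessThan)

lemma sum_residue_parity: "sum_residue n p mod 2 = odd_count p mod 2"
proof -
  have "2 dvd 2 * n - 2" by simp
  then have "sum_residue n p mod 2 = sum_list p mod 2"
    unfolding sum_residue_def by (rule mod_mod_cancel)
  also have "\<dots> = odd_count p mod 2"
    by (simp add: sum_list_eq_sum odd_count_eq_sum mod_sum_eq)
  finally show ?thesis .
qed

text \<open>The heights sum to \<open>(n - 1) * T + e\<close> with \<open>e \<le> n - 2\<close>, so
  the residue is \<open>e\<close> for even \<open>T\<close> and \<open>n - 1 + e\<close> for odd
  \<open>T\<close>; the odd count is \<open>v\<close> or \<open>n - v\<close>, respectively.\<close>

lemma cold_iff_residue:
  assumes n: "n \<ge> 2" and len: "length p = n" and hor: "horizon p T" and le: "\<forall>i<n. p ! i \<le> T"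
  shows "cold p T \<longleftrightarrow> (sum_residue n p, odd_count p) \<in> S1 n \<union> S2 n \<union> S3 n"
proof -
  define e where "e = T - deficit p T"
  have dT: "deficit p T + e = T" using hor by (simp add: horizon_def e_def)
  \<comment> \<open>No stack exceeds \<open>T\<close>, so all \<open>n\<close> terms grow from
    \<open>T\<close> to \<open>T + 1\<close>; this bounds \<open>e\<close> by
    \<open>n - 2\<close>.\<close>
  have "(\<Sum>i<n. (T + 1 - p ! i)) = (\<Sum>i<n. (T - p ! i) + 1)"
    using le by (intro sum.cong) (auto simp: Suc_diff_le)
  then have "deficit p (T + 1) = deficit p T + n"
    by (simp add: deficit_def len sum_Suc)
  then have e: "e + 2 \<le> n" using hor dT by (auto simp: horizon_def)
  have "sum_list p + deficit p T = (\<Sum>i<n. p ! i + (T - p ! i))"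
    by (simp add: sum_list_eq_sum deficit_def len sum.distrib)
  also have "\<dots> = n * T" using le by simp
  finally have "sum_list p + deficit p T = (n - 1) * T + T" using n by (simp add: algebra_simps)
  then have sum: "sum_list p = (n - 1) * T + e" using dT by linarith
  define v where "v = odd_deficits p T"
  have v: "v mod 2 = deficit p T mod 2" by (simp add: v_def odd_deficits_parity)
  have parity: "sum_residue n p mod 2 = odd_count p mod 2" by (rule sum_residue_parity)
  show ?thesis
  proof (cases "even T")
    case True
    then obtain a where "T = 2 * a" by blast
    then have "sum_list p = (2 * n - 2) * a + e" using sum by (simp add: algebra_simps)
    then have s: "sum_residue n p = e" using e by (simp add: sum_residue_def)
    have "odd_count p = v"
      unfolding odd_count_eq_sum v_def odd_deficits_def
    proof (intro sum.cong refl)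
      fix i assume "i \<in> {..<length p}"
      then have "p ! i \<le> T" using le len by simp
      then show "p ! i mod 2 = (T - p ! i) mod 2" using True by (auto simp: mod2_eq_if)
    qed
    moreover from this have "v mod 2 = e mod 2" using parity s by simp
    moreover have "cold p T \<longleftrightarrow> v \<le> e" using True by (simp add: cold_def v_def e_def)
    ultimately show ?thesis using s e
      by (cases "e = n - 2") (auto simp: S1_def S2_def S3_def mod2_eq_if)
  next
    case False
    then obtain a where "T = 2 * a + 1" by (rule oddE)
    then have "sum_list p = (2 * n - 2) * a + (n - 1 + e)" using sum by (simp add: algebra_simps)
    then have "sum_residue n p = (n - 1 + e) mod (2 * n - 2)"
      unfolding sum_residue_def by (simp only: mod_mult_self4)
    then have s: "sum_residue n p = n - 1 + e" using e by simp
    have "odd_count p + v = (\<Sum>i<n. p ! i mod 2 + (T - p ! i) mod 2)"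
      unfolding odd_count_eq_sum v_def odd_deficits_def by (simp add: sum.distrib len)
    also have "\<dots> = (\<Sum>i<n. 1)"
    proof (intro sum.cong refl)
      fix i assume "i \<in> {..<n}"
      then have "p ! i \<le> T" using le by simp
      then show "p ! i mod 2 + (T - p ! i) mod 2 = 1" using False by (auto simp: mod2_eq_if)
    qed
    finally have o: "odd_count p + v = n" by simp
    have "(deficit p T + e) mod 2 = 1" using dT False by (simp add: odd_iff_mod_2_eq_one)
    \<comment> \<open>Parity closes a gap of one: \<open>cold\<close> means
      \<open>v \<ge> e + 2\<close>, whereas the bounds of \<open>S3\<close> amount to
      \<open>v \<ge> e + 3\<close>.\<close>
    then have ve: "v \<noteq> e + 2" using v by presburger
    have "cold p T \<longleftrightarrow> e + 1 < v" using False by (simp add: cold_def v_def e_def)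
    also have "\<dots> \<longleftrightarrow> n - 1 + e < 2 * n - 3 \<and> odd_count p \<le> 2 * (n - 2) - (n - 1 + e)"
      using o e ve by linarith
    also have "\<dots> \<longleftrightarrow> (sum_residue n p, odd_count p) \<in> S1 n \<union> S2 n \<union> S3 n"
      using parity n unfolding s by (auto simp: S1_def S2_def S3_def)
    finally show ?thesis .
  qed
qed

theorem theorem6:
  fixes n :: nat
  assumes "n \<ge> 2"
  shows "(\<forall>p \<in> sn_positions n. sum_residue n p mod 2 = odd_count p mod 2) \<and>
         (\<forall>p \<in> sn_positions n. sn_reduced n {n - 1, n} p \<longrightarrow>
            (P_position n {n - 1, n} p \<longleftrightarrow>
             (sum_residue n p, odd_count p) \<in> S1 n \<union> S2 n \<union> S3 n))"
proof (intro conjI ballI impI)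
  fix p
  show "sum_residue n p mod 2 = odd_count p mod 2" by (rule sum_residue_parity)
next
  fix p
  assume "p \<in> sn_positions n" and red: "sn_reduced n {n - 1, n} p"
  then have len: "length p = n" by (simp add: sn_positions_def)
  obtain T where hor: "horizon p T" using horizon_exists assms len by blast
  have "\<forall>i<n. p ! i \<le> T" using reduced_height_le[OF assms len hor red] by blast
  then show "P_position n {n - 1, n} p \<longleftrightarrow>
      (sum_residue n p, odd_count p) \<in> S1 n \<union> S2 n \<union> S3 n"
    using P_position_iff_cold[OF assms len hor] cold_iff_residue[OF assms len hor] by simp
qed

end
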